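(* Suppose that $f(z)=h(z)+\overline{g(z)}=\sum_{n=0}^\infty a_n z^n+\overline{\sum_{n=1}^\infty b_n z^n}$ is a sense-preserving harmonic mapping of the unit disk $\mathbb{D}$, where $h$ satisfies $\mathrm{Re}\,h(z)\le 1$ in $\mathbb{D}$ and $h(0)=a_0$ is positive. Then $$a_0+\sum_{n=1}^\infty(|a_n|+|b_n|)r^n\le 1\quad\text{for } 0\le r\le\frac15,$$ and the number $1/5$ is sharp, i.e. for every $r\in(1/5,1)$ there is such an $f$ for which the inequality fails at $r$.
   Context: $\mathbb{D}=\{z\in\mathbb{C}:|z|<1\}$. A harmonic mapping in $\mathbb{D}$ is a complex-valued function $f$ with $\Delta f=0$; it is written $f=h+\overline{g}$ with $h,g$ analytic in $\mathbb{D}$ and $g(0)=0$, where $h(z)=\sum_{n\ge0}a_nz^n$ and $g(z)=\sum_{n\ge1}b_nz^n$. It is (locally univalent and) sense-preserving if its Jacobian $J_f=|h'|^2-|g'|^2$ is positive in $\mathbb{D}$; equivalently $h'\neq0$ and the dilatation $\omega_f=g'/h'$ satisfies $|\omega_f|<1$ in $\mathbb{D}$. *)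

theory Defs
  imports "HOL-Complex_Analysis.Complex_Analysis"
begin

text \<open>
  Partial derivatives with respect to \<open>x = Re z\<close> and \<open>y = Im z\<close>. They are only used at points
  where the function is real differentiable, so that \<^const>\<open>frechet_derivative\<close> is meaningful.
\<close>

definition dx :: "(complex \<Rightarrow> complex) \<Rightarrow> complex \<Rightarrow> complex" where
  "dx f z = frechet_derivative f (at z) 1"

definition dy :: "(complex \<Rightarrow> complex) \<Rightarrow> complex \<Rightarrow> complex" where
  "dy f z = frechet_derivative f (at z) \<i>"

definition laplacian :: "(complex \<Rightarrow> complex) \<Rightarrow> complex \<Rightarrow> complex" where
  "laplacian f z = dx (dx f) z + dy (dy f) z"

definition C2_on :: "(complex \<Rightarrow> complex) \<Rightarrow> complex set \<Rightarrow> bool" where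
  "C2_on f S \<longleftrightarrow>
     (\<forall>z\<in>S. f differentiable (at z) \<and> dx f differentiable (at z) \<and> dy f differentiable (at z)) \<and>
     continuous_on S (dx (dx f)) \<and> continuous_on S (dy (dx f)) \<and>
     continuous_on S (dx (dy f)) \<and> continuous_on S (dy (dy f))"

definition harmonic_on :: "(complex \<Rightarrow> complex) \<Rightarrow> complex set \<Rightarrow> bool" where
  "harmonic_on f S \<longleftrightarrow> C2_on f S \<and> (\<forall>z\<in>S. laplacian f z = 0)"

text \<open>With \<open>f = u + i v\<close> this is \<open>u_x v_y - v_x u_y\<close>.\<close>

definition jacobian_det :: "(complex \<Rightarrow> complex) \<Rightarrow> complex \<Rightarrow> real" where
  "jacobian_det f z = Re (dx f z) * Im (dy f z) - Im (dx f z) * Re (dy f z)"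

definition sense_preserving_harmonic_on :: "(complex \<Rightarrow> complex) \<Rightarrow> complex set \<Rightarrow> bool" where
  "sense_preserving_harmonic_on f S \<longleftrightarrow> harmonic_on f S \<and> (\<forall>z\<in>S. 0 < jacobian_det f z)"

abbreviation unit_disk :: "complex set" where
  "unit_disk \<equiv> ball 0 1"

text \<open>
  The decomposition \<open>f = h + cnj g\<close> with its two power series. The series of \<open>g\<close> starts at index
  1, so \<open>g 0 = 0\<close>; the value \<open>b 0\<close> is irrelevant.
\<close>

definition harmonic_series ::
  "(complex \<Rightarrow> complex) \<Rightarrow> (complex \<Rightarrow> complex) \<Rightarrow> (complex \<Rightarrow> complex) \<Rightarrow>
   (nat \<Rightarrow> complex) \<Rightarrow> (nat \<Rightarrow> complex) \<Rightarrow> bool" where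
  "harmonic_series f h g a b \<longleftrightarrow>
     h holomorphic_on unit_disk \<and> g holomorphic_on unit_disk \<and>
     (\<forall>z\<in>unit_disk. f z = h z + cnj (g z)) \<and>
     (\<forall>z\<in>unit_disk. (\<lambda>n. a n * z ^ n) sums h z) \<and>
     (\<forall>z\<in>unit_disk. (\<lambda>n. b (Suc n) * z ^ Suc n) sums g z)"

text \<open>
  For \<open>f = h + cnj g\<close> with \<open>h\<close>, \<open>g\<close> holomorphic, the definitions above give the usual facts:
  \<open>f\<close> is harmonic and its Jacobian is \<open>|h'|^2 - |g'|^2\<close>.
\<close>

lemma harmonic_decomp_derivs:
  assumes S: "open S" and h: "h holomorphic_on S" and g: "g holomorphic_on S"
    and f: "\<And>z. z \<in> S \<Longrightarrow> f z = h z + cnj (g z)" and z: "z \<in> S"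
  shows "f differentiable (at z)"
    and "dx f z = deriv h z + cnj (deriv g z)"
    and "dy f z = \<i> * deriv h z + cnj (\<i> * deriv g z)"
proof -
  have dh: "(h has_derivative (\<lambda>v. deriv h z * v)) (at z)"
    using holomorphic_derivI[OF h S z] by (simp add: has_field_derivative_def)
  have dg: "(g has_derivative (\<lambda>v. deriv g z * v)) (at z)"
    using holomorphic_derivI[OF g S z] by (simp add: has_field_derivative_def)
  have "((\<lambda>z. h z + cnj (g z)) has_derivative (\<lambda>v. deriv h z * v + cnj (deriv g z * v))) (at z)"
    by (intro has_derivative_add dh bounded_linear.has_derivative[OF bounded_linear_cnj] dg)
  then have D: "(f has_derivative (\<lambda>v. deriv h z * v + cnj (deriv g z * v))) (at z)"
    by (rule has_derivative_transform_within_open[OF _ S z]) (simp add: f)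
  then show "f differentiable (at z)"
    by (auto simp: differentiable_def)
  have E: "frechet_derivative f (at z) = (\<lambda>v. deriv h z * v + cnj (deriv g z * v))"
    using frechet_derivative_at[OF D] by simp
  show "dx f z = deriv h z + cnj (deriv g z)"
    "dy f z = \<i> * deriv h z + cnj (\<i> * deriv g z)"
    by (simp_all add: dx_def dy_def E mult.commute)
qed

lemma harmonic_on_decomp:
  assumes S: "open S" and h: "h holomorphic_on S" and g: "g holomorphic_on S"
    and f: "\<And>z. z \<in> S \<Longrightarrow> f z = h z + cnj (g z)"
  shows "harmonic_on f S"
proof -
  note D = harmonic_decomp_derivs[OF S]
  have h': "deriv h holomorphic_on S" and g': "deriv g holomorphic_on S"
    using S h g by (auto intro: holomorphic_deriv)
  have ih': "(\<lambda>z. \<i> * deriv h z) holomorphic_on S" and ig': "(\<lambda>z. \<i> * deriv g z) holomorphic_on S"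
    using h' g' by (auto intro: holomorphic_intros)
  have h'': "deriv (deriv h) holomorphic_on S" and g'': "deriv (deriv g) holomorphic_on S"
    using S h' g' by (auto intro: holomorphic_deriv)
  have di: "deriv (\<lambda>z. \<i> * deriv h z) z = \<i> * deriv (deriv h) z"
    "deriv (\<lambda>z. \<i> * deriv g z) z = \<i> * deriv (deriv g) z" if "z \<in> S" for z
    using h' g' S that by (auto intro!: deriv_cmult holomorphic_on_imp_differentiable_at)
  note Df = D[OF h g f]
  have fx: "dx f z = deriv h z + cnj (deriv g z)"
    and fy: "dy f z = \<i> * deriv h z + cnj (\<i> * deriv g z)" if "z \<in> S" for z
    using Df(2,3) that by blast+
  note Dx = D[of "deriv h" "deriv g" "dx f", OF h' g' fx]
  note Dy = D[of "\<lambda>z. \<i> * deriv h z" "\<lambda>z. \<i> * deriv g z" "dy f", OF ih' ig' fy]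
  have c: "continuous_on S (deriv (deriv h))" "continuous_on S (deriv (deriv g))"
    using h'' g'' by (auto intro: holomorphic_on_imp_continuous_on)
  have xx: "dx (dx f) z = deriv (deriv h) z + cnj (deriv (deriv g) z)"
    and yx: "dy (dx f) z = \<i> * deriv (deriv h) z + cnj (\<i> * deriv (deriv g) z)"
    and xy: "dx (dy f) z = \<i> * deriv (deriv h) z + cnj (\<i> * deriv (deriv g) z)"
    and yy: "dy (dy f) z = \<i> * (\<i> * deriv (deriv h) z) + cnj (\<i> * (\<i> * deriv (deriv g) z))"
    if "z \<in> S" for z
    using Dx(2,3) Dy(2,3) di that by simp_all
  have "continuous_on S (\<lambda>z. deriv (deriv h) z + cnj (deriv (deriv g) z))"
    "continuous_on S (\<lambda>z. \<i> * deriv (deriv h) z + cnj (\<i> * deriv (deriv g) z))"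
    "continuous_on S (\<lambda>z. \<i> * (\<i> * deriv (deriv h) z) + cnj (\<i> * (\<i> * deriv (deriv g) z)))"
    by (intro continuous_intros c)+
  then have "continuous_on S (dx (dx f))" "continuous_on S (dy (dx f))"
    "continuous_on S (dx (dy f))" "continuous_on S (dy (dy f))"
    using xx yx xy yy by (simp_all cong: continuous_on_cong)
  moreover have "laplacian f z = 0" if "z \<in> S" for z
    using xx[OF that] yy[OF that] by (simp add: laplacian_def flip: mult.assoc)
  ultimately show ?thesis
    using Df(1) Dx(1) Dy(1) by (simp add: harmonic_on_def C2_on_def)
qed

lemma jacobian_det_decomp:
  assumes "open S" "h holomorphic_on S" "g holomorphic_on S"
    and "\<And>z. z \<in> S \<Longrightarrow> f z = h z + cnj (g z)" and "z \<in> S"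
  shows "jacobian_det f z = (cmod (deriv h z))\<^sup>2 - (cmod (deriv g z))\<^sup>2"
  using harmonic_decomp_derivs(2,3)[OF assms]
  by (simp add: jacobian_det_def cmod_power2) (simp add: power2_eq_square algebra_simps)

end

theory Submission
  imports Defs
begin

\<comment> \<open>Reserves \<open>$\<close> for the coefficients of formal power series.\<close>
unbundle no vec_syntax

text \<open>
  Write \<open>A(s) = \<Sum>\<^sub>n\<^sub>\<ge>\<^sub>1 |a\<^sub>n| s\<^sup>n\<close> and \<open>B(s) = \<Sum>\<^sub>n\<^sub>\<ge>\<^sub>1 |b\<^sub>n| s\<^sup>n\<close>. Two facts give the inequality.

  The half-plane condition \<open>Re h \<le> 1\<close> forces \<open>|a\<^sub>n| \<le> 2 (1 - a\<^sub>0)\<close> for \<open>n \<ge> 1\<close>, by the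
  Caratheodory coefficient estimate applied to \<open>1 - h\<close>
  (\<open>caratheodory_coeff_bound\<close>, \<open>coeff_bound_of_Re_le_one\<close>). Hence
  \<open>A(r) \<le> 2 (1 - a\<^sub>0) r / (1 - r)\<close>.

  The series of \<open>g\<close> is no larger: \<open>B(r) \<le> A(r)\<close> for \<open>r \<le> 1/3\<close>. Indeed \<open>g' = w h'\<close> where the
  dilatation \<open>w\<close> is bounded by 1. The same half-plane estimate, applied to a rotation of \<open>w\<close>,
  yields Bohr's inequality \<open>\<Sum> |w\<^sub>n| s\<^sup>n \<le> 1\<close> for \<open>s \<le> 1/3\<close> (\<open>bohr_inequality\<close>). Multiplying out
  the product \<open>w h'\<close> gives \<open>B'(s) \<le> A'(s)\<close> on \<open>[0, 1/3]\<close>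
  (\<open>majorant_series_le_of_bounded_factor\<close>), and
  integrating from 0 gives the claim (\<open>majorant_series_le_of_deriv\<close>).

  Together, \<open>a\<^sub>0 + A(r) + B(r) \<le> a\<^sub>0 + (1 - a\<^sub>0) 4 r / (1 - r)\<close>, and \<open>4 r / (1 - r) \<le> 1\<close> says exactly
  \<open>r \<le> 1/5\<close>. Both facts are sharp in the limit: take for \<open>h\<close> a conformal map onto the half-plane
  \<open>{Re < 1}\<close>, whose coefficients of index \<open>n \<ge> 1\<close> all attain the bound, and for the dilatation a
  constant close to 1 (\<open>half_plane_shear_exceeds_one\<close>).
\<close>

section \<open>Taylor coefficients of functions with values in a half-plane\<close>

text \<open>
  Cauchy's formula for the Taylor coefficients, as an integral over the angle in units of a full
  turn. In this form real and imaginary parts can be separated under the integral.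
\<close>

lemma circle_integral_coeff:
  assumes p: "p holomorphic_on unit_disk" and P: "p has_fps_expansion P" and r: "0 < r" "r < 1"
  shows "((\<lambda>t. p (of_real r * exp (2 * of_real pi * \<i> * of_real t)) / exp (2 * of_real pi * \<i> * of_real t) ^ n)
           has_integral (P $ n * of_real r ^ n)) {0..1::real}"
proof -
  have *: "((\<lambda>u. p u / (u - 0) ^ Suc n) has_contour_integral
          ((2 * pi * \<i>) / (fact n) * (deriv ^^ n) p 0)) (circlepath 0 r)"
    by (rule Cauchy_has_contour_integral_higher_derivative_circlepath)
       (use r in \<open>auto intro!: holomorphic_on_imp_continuous_on holomorphic_on_subset[OF p]\<close>)
  have "P $ n = (deriv ^^ n) p 0 / fact n"
    by (rule fps_nth_fps_expansion[OF P])
  with * have "((\<lambda>u. p u / u ^ Suc n) has_contour_integral (2 * pi * \<i> * P $ n)) (circlepath 0 r)"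
    by simp
  then have "((\<lambda>t. p (circlepath 0 r t) / circlepath 0 r t ^ Suc n *
       vector_derivative (circlepath 0 r) (at t within {0..1})) has_integral (2 * pi * \<i> * P $ n)) {0..1}"
    by (simp add: has_contour_integral_def)
  then have "((\<lambda>t. (of_real r ^ n / (2 * pi * \<i>)) * (p (circlepath 0 r t) / circlepath 0 r t ^ Suc n *
       vector_derivative (circlepath 0 r) (at t within {0..1})))
        has_integral ((of_real r ^ n / (2 * pi * \<i>)) * (2 * pi * \<i> * P $ n))) {0..1}"
    by (rule has_integral_mult_right)
  moreover have "(of_real r ^ n / (2 * pi * \<i>)) * (2 * pi * \<i> * P $ n) = P $ n * of_real r ^ n"
    by (simp add: field_simps)
  ultimately have I: "((\<lambda>t. (of_real r ^ n / (2 * pi * \<i>)) * (p (circlepath 0 r t) / circlepath 0 r t ^ Suc n *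
       vector_derivative (circlepath 0 r) (at t within {0..1})))
        has_integral (P $ n * of_real r ^ n)) {0..1}"
    by metis
  show ?thesis
    by (rule has_integral_eq[OF _ I])
       (use r in \<open>simp add: vector_derivative_circlepath01 power_mult_distrib,
         simp add: circlepath power_mult_distrib, simp add: mult_ac\<close>)
qed

text \<open>
  The negative Fourier coefficients of \<open>p\<close> on a circle vanish: they are the coefficients of index 0
  of \<open>p z * z ^ n\<close>.
\<close>

lemma circle_integral_negative_coeff:
  assumes p: "p holomorphic_on unit_disk" and r: "0 < r" "r < 1" and n: "n > 0"
  shows "((\<lambda>t. p (of_real r * exp (2 * of_real pi * \<i> * of_real t)) * exp (2 * of_real pi * \<i> * of_real t) ^ n)
           has_integral 0) {0..1::real}"
proof -
  obtain Q where Q: "(\<lambda>z. p z * z ^ n) has_fps_expansion Q" and Q0: "Q $ 0 = 0"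
  proof
    have P: "p has_fps_expansion fps_expansion p 0"
      by (rule has_fps_expansion_fps_expansion[OF open_ball _ p]) simp
    show "(\<lambda>z. p z * z ^ n) has_fps_expansion fps_expansion p 0 * fps_X ^ n"
      by (intro has_fps_expansion_mult P has_fps_expansion_fps_X_power)
    show "(fps_expansion p 0 * fps_X ^ n) $ 0 = 0" using n by simp
  qed
  have "(\<lambda>z. p z * z ^ n) holomorphic_on unit_disk"
    by (intro holomorphic_intros p)
  from circle_integral_coeff[OF this Q r, of 0] Q0
  have "((\<lambda>t. of_real r ^ n * (p (of_real r * exp (2 * of_real pi * \<i> * of_real t)) * exp (2 * of_real pi * \<i> * of_real t) ^ n))
           has_integral 0) {0..1::real}"
    by (simp add: power_mult_distrib mult_ac)
  from has_integral_mult_right[OF this, of "inverse (of_real r ^ n)"] r show ?thesis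
    by (simp flip: mult.assoc)
qed

text \<open>
  On the circle of radius \<open>r\<close> the \<open>n\<close>-th Fourier coefficient of \<open>cnj q\<close> vanishes for \<open>n > 0\<close>, so
  \<open>Q\<^sub>n r\<^sup>n\<close> is also the \<open>n\<close>-th Fourier coefficient of \<open>q + cnj q = 2 Re q\<close>. As \<open>Re q\<close> is nonnegative,
  the triangle inequality bounds this by the mean of \<open>2 Re q\<close>, which is \<open>2 Re Q\<^sub>0\<close>. Then
  \<open>r\<close> tends to 1.
\<close>

lemma caratheodory_coeff_bound:
  assumes q: "q holomorphic_on unit_disk" and Q: "q has_fps_expansion Q"
    and pos: "\<And>z. z \<in> unit_disk \<Longrightarrow> Re (q z) \<ge> 0" and n: "n > 0"
  shows "norm (Q $ n) \<le> 2 * Re (Q $ 0)"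
proof -
  have bound: "norm (Q $ n) * r ^ n \<le> 2 * Re (Q $ 0)" if r: "0 < r" "r < 1" for r :: real
  proof -
    define e where "e = (\<lambda>t::real. exp (2 * of_real pi * \<i> * of_real t))"
    have ne: "norm (e t) = 1" for t
      by (simp add: e_def)
    have cnj_e: "cnj (e t) = inverse (e t)" for t
      by (simp add: e_def exp_cnj exp_minus)
    have I1: "((\<lambda>t. q (of_real r * e t) / e t ^ n) has_integral (Q $ n * of_real r ^ n)) {0..1}"
      unfolding e_def by (rule circle_integral_coeff[OF q Q r])
    have "((\<lambda>t. q (of_real r * e t) * e t ^ n) has_integral 0) {0..1}"
      unfolding e_def by (rule circle_integral_negative_coeff[OF q r n])
    from has_integral_linear[OF this bounded_linear_cnj]
    have I2: "((\<lambda>t. cnj (q (of_real r * e t)) / e t ^ n) has_integral 0) {0..1}"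
      by (simp add: o_def cnj_e divide_inverse power_inverse)
    have I: "((\<lambda>t. of_real (2 * Re (q (of_real r * e t))) / e t ^ n) has_integral (Q $ n * of_real r ^ n)) {0..1}"
      using has_integral_add[OF I1 I2]
      by (simp add: complex_add_cnj flip: add_divide_distrib)
    have "((\<lambda>t. q (of_real r * e t)) has_integral Q $ 0) {0..1}"
      using circle_integral_coeff[OF q Q r, of 0] by (simp add: e_def)
    from has_integral_mult_right[OF has_integral_linear[OF this bounded_linear_Re], of 2]
    have J: "((\<lambda>t. 2 * Re (q (of_real r * e t))) has_integral 2 * Re (Q $ 0)) {0..1}"
      by (simp add: o_def)
    have "norm (integral {0..1} (\<lambda>t. complex_of_real (2 * Re (q (of_real r * e t))) / e t ^ n))
        \<le> integral {0..1} (\<lambda>t. 2 * Re (q (of_real r * e t)))"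
    proof (rule integral_norm_bound_integral)
      show "norm (complex_of_real (2 * Re (q (of_real r * e t))) / e t ^ n) \<le> 2 * Re (q (of_real r * e t))" for t
        using pos[of "of_real r * e t"] r
        by (simp add: norm_divide norm_power ne norm_mult)
    qed (use I J in blast)+
    then have "norm (Q $ n * of_real r ^ n) \<le> 2 * Re (Q $ 0)"
      unfolding integral_unique[OF I] integral_unique[OF J] .
    with r show ?thesis
      by (simp add: norm_mult norm_power)
  qed
  show ?thesis
  proof (rule tendsto_upperbound)
    show "((\<lambda>r. norm (Q $ n) * r ^ n) \<longlongrightarrow> norm (Q $ n)) (at_left (1::real))"
      by (auto intro!: tendsto_eq_intros)
    show "\<forall>\<^sub>F r in at_left (1::real). norm (Q $ n) * r ^ n \<le> 2 * Re (Q $ 0)"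
      using eventually_at_left_real[of 0 1] by (auto elim!: eventually_mono intro!: bound)
  qed simp
qed

lemma coeff_bound_of_Re_le_one:
  assumes p: "p holomorphic_on unit_disk" and P: "p has_fps_expansion P"
    and le: "\<And>z. z \<in> unit_disk \<Longrightarrow> Re (p z) \<le> 1" and n: "n > 0"
  shows "norm (P $ n) \<le> 2 * (1 - Re (P $ 0))"
proof -
  have "(\<lambda>z. 1 - p z) has_fps_expansion 1 - P"
    by (intro has_fps_expansion_diff has_fps_expansion_1 P)
  moreover have "(\<lambda>z. 1 - p z) holomorphic_on unit_disk"
    by (intro holomorphic_intros p)
  ultimately show ?thesis
    using caratheodory_coeff_bound[of "\<lambda>z. 1 - p z" "1 - P" n] n le by simp
qed

section \<open>Bohr's inequality and majorant series\<close>

lemma summable_norm_coeffs: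
  fixes P :: "complex fps"
  assumes "p holomorphic_on unit_disk" and "p has_fps_expansion P" and "0 \<le> s" "s < 1"
  shows "summable (\<lambda>n. norm (P $ n) * s ^ n)"
proof -
  have "fps_conv_radius P \<ge> ereal 1"
    by (rule holomorphic_on_imp_fps_conv_radius_ge[OF assms(2)]) (use assms in simp)
  moreover have "ereal (norm (complex_of_real s)) < ereal 1" using assms by simp
  ultimately have "summable (\<lambda>n. norm (P $ n * of_real s ^ n))"
    by (intro norm_summable_fps) (rule less_le_trans)
  then show ?thesis
    using assms by (simp add: norm_mult norm_power)
qed

text \<open>
  If \<open>c = |W\<^sub>0|\<close>, the remaining coefficients are at most \<open>2 (1 - c)\<close> in modulus, so the sum is at
  most \<open>c + (1 - c) 2 s / (1 - s)\<close>; the last fraction is at most 1 exactly when \<open>s \<le> 1/3\<close>.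
\<close>

lemma bohr_inequality:
  assumes w: "w holomorphic_on unit_disk" and W: "w has_fps_expansion W"
    and le: "\<And>z. z \<in> unit_disk \<Longrightarrow> norm (w z) \<le> 1" and s: "0 \<le> s" "s \<le> 1 / 3"
  shows "(\<Sum>n. norm (W $ n) * s ^ n) \<le> 1"
proof -
  define c where "c = norm (W $ 0)"
  \<comment> \<open>Rotating \<open>w\<close> makes its value at 0 real, so that the bound for \<open>Re w \<le> 1\<close> involves \<open>|w 0|\<close>.\<close>
  obtain u where nu: "norm u = 1" and u0: "u * W $ 0 = of_real c"
  proof (cases "W $ 0 = 0")
    case True
    then show ?thesis using that[of 1] by (simp add: c_def)
  next
    case False
    then have "norm (cnj (sgn (W $ 0))) = 1"
      by (simp add: norm_sgn)
    moreover have "cnj (sgn (W $ 0)) * W $ 0 = of_real c"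
      using False complex_norm_square[of "W $ 0"]
      by (simp add: c_def sgn_eq power2_eq_square field_simps)
    ultimately show ?thesis by (rule that)
  qed
  have "W $ 0 = w 0"
    using fps_nth_fps_expansion[OF W, of 0] by simp
  then have c1: "c \<le> 1" using le[of 0] by (simp add: c_def)
  have tail: "norm (W $ Suc n) \<le> 2 * (1 - c)" for n
  proof -
    have U: "(\<lambda>z. u * w z) has_fps_expansion fps_const u * W"
      by (rule has_fps_expansion_cmult_left[OF W])
    have "Re (u * w z) \<le> 1" if "z \<in> unit_disk" for z
    proof -
      have "Re (u * w z) \<le> norm (u * w z)" by (rule complex_Re_le_cmod)
      also have "\<dots> \<le> 1" using nu le[OF that] by (simp add: norm_mult)
      finally show ?thesis .
    qed
    from coeff_bound_of_Re_le_one[OF _ U this, of "Suc n"] w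
    have "norm (u * W $ Suc n) \<le> 2 * (1 - c)"
      by (simp add: u0 holomorphic_intros)
    then show ?thesis using nu by (simp add: norm_mult)
  qed
  have sm: "summable (\<lambda>n. norm (W $ n) * s ^ n)"
    by (rule summable_norm_coeffs[OF w W]) (use s in auto)
  have geo: "(\<lambda>n. 2 * (1 - c) * (s * s ^ n)) sums (2 * (1 - c) * (s * (1 / (1 - s))))"
    by (intro sums_mult geometric_sums) (use s in auto)
  have "(\<Sum>n. norm (W $ n) * s ^ n) = c + (\<Sum>n. norm (W $ Suc n) * s ^ Suc n)"
    using suminf_split_head[OF sm] by (simp add: c_def)
  also have "(\<Sum>n. norm (W $ Suc n) * s ^ Suc n) \<le> (\<Sum>n. 2 * (1 - c) * (s * s ^ n))"
  proof (rule suminf_le)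
    show "norm (W $ Suc n) * s ^ Suc n \<le> 2 * (1 - c) * (s * s ^ n)" for n
      using mult_right_mono[OF tail[of n], of "s ^ Suc n"] s by simp
    show "summable (\<lambda>n. norm (W $ Suc n) * s ^ Suc n)"
      using sm by (subst summable_Suc_iff)
    show "summable (\<lambda>n. 2 * (1 - c) * (s * s ^ n))"
      using geo by (rule sums_summable)
  qed
  also have "\<dots> = (1 - c) * (2 * s / (1 - s))"
    unfolding sums_unique[OF geo, symmetric] by simp
  also have "\<dots> \<le> (1 - c) * 1"
    by (rule mult_left_mono) (use s c1 in \<open>auto simp: field_simps\<close>)
  finally show ?thesis by simp
qed

text \<open>
  The majorant series of a product is at most the product of the majorant series, and by
  Bohr's inequality the factor that belongs to \<open>w\<close> is at most 1.
\<close>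

lemma majorant_series_le_of_bounded_factor:
  assumes f: "f holomorphic_on unit_disk" and F: "f has_fps_expansion F"
    and w: "w holomorphic_on unit_disk" and W: "w has_fps_expansion W"
    and le: "\<And>z. z \<in> unit_disk \<Longrightarrow> norm (w z) \<le> 1" and s: "0 \<le> s" "s \<le> 1 / 3"
  shows "(\<Sum>n. norm ((W * F) $ n) * s ^ n) \<le> (\<Sum>n. norm (F $ n) * s ^ n)"
proof -
  have s1: "s < 1" using s by simp
  have sF: "summable (\<lambda>n. norm (F $ n) * s ^ n)"
    by (rule summable_norm_coeffs[OF f F s(1) s1])
  have sW: "summable (\<lambda>n. norm (W $ n) * s ^ n)"
    by (rule summable_norm_coeffs[OF w W s(1) s1])
  have prod: "(\<lambda>n. \<Sum>i\<le>n. (norm (W $ i) * s ^ i) * (norm (F $ (n - i)) * s ^ (n - i)))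
      sums ((\<Sum>n. norm (W $ n) * s ^ n) * (\<Sum>n. norm (F $ n) * s ^ n))"
    by (rule Cauchy_product_sums) (use sF sW s in simp_all)
  have "(\<Sum>n. norm ((W * F) $ n) * s ^ n)
      \<le> (\<Sum>n. \<Sum>i\<le>n. (norm (W $ i) * s ^ i) * (norm (F $ (n - i)) * s ^ (n - i)))"
  proof (rule suminf_le)
    show "summable (\<lambda>n. norm ((W * F) $ n) * s ^ n)"
      by (rule summable_norm_coeffs[OF holomorphic_on_mult[OF w f] has_fps_expansion_mult[OF W F] s(1) s1])
    show "summable (\<lambda>n. \<Sum>i\<le>n. (norm (W $ i) * s ^ i) * (norm (F $ (n - i)) * s ^ (n - i)))"
      using prod by (rule sums_summable)
    show "norm ((W * F) $ n) * s ^ n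
        \<le> (\<Sum>i\<le>n. (norm (W $ i) * s ^ i) * (norm (F $ (n - i)) * s ^ (n - i)))" for n
    proof -
      have "norm ((W * F) $ n) \<le> (\<Sum>i\<le>n. norm (W $ i) * norm (F $ (n - i)))"
        unfolding fps_mult_nth atLeast0AtMost
        by (rule order_trans[OF norm_sum]) (simp add: norm_mult)
      then have "norm ((W * F) $ n) * s ^ n \<le> (\<Sum>i\<le>n. norm (W $ i) * norm (F $ (n - i))) * s ^ n"
        by (rule mult_right_mono) (use s in simp)
      also have "\<dots> = (\<Sum>i\<le>n. (norm (W $ i) * s ^ i) * (norm (F $ (n - i)) * s ^ (n - i)))"
        unfolding sum_distrib_right
      proof (rule sum.cong[OF refl])
        fix i assume "i \<in> {..n}"
        then have "s ^ n = s ^ i * s ^ (n - i)"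
          by (simp flip: power_add)
        then show "norm (W $ i) * norm (F $ (n - i)) * s ^ n
          = norm (W $ i) * s ^ i * (norm (F $ (n - i)) * s ^ (n - i))"
          by simp
      qed
      finally show ?thesis .
    qed
  qed
  also have "\<dots> = (\<Sum>n. norm (W $ n) * s ^ n) * (\<Sum>n. norm (F $ n) * s ^ n)"
    using prod by (simp add: sums_iff)
  also have "\<dots> \<le> 1 * (\<Sum>n. norm (F $ n) * s ^ n)"
    by (rule mult_right_mono[OF bohr_inequality[OF w W le s]])
       (use s in \<open>auto intro!: suminf_nonneg sF\<close>)
  finally show ?thesis by simp
qed

text \<open>
  The derivative of a majorant series is the majorant series of the derivative, so an inequality
  between the latter integrates from 0. The constant terms, which are lost in the derivative,
  are left out of the conclusion.
\<close>

lemma majorant_series_le_of_deriv: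
  fixes H G :: "complex fps"
  assumes h: "h holomorphic_on unit_disk" and H: "h has_fps_expansion H"
    and g: "g holomorphic_on unit_disk" and G: "g has_fps_expansion G"
    and le: "\<And>s. 0 \<le> s \<Longrightarrow> s \<le> R \<Longrightarrow>
      (\<Sum>n. norm (fps_deriv G $ n) * s ^ n) \<le> (\<Sum>n. norm (fps_deriv H $ n) * s ^ n)"
    and r: "0 \<le> r" "r \<le> R" "R < 1"
  shows "(\<Sum>n. norm (G $ Suc n) * r ^ Suc n) \<le> (\<Sum>n. norm (H $ Suc n) * r ^ Suc n)"
proof -
  define D where "D = (\<lambda>s. (\<Sum>n. norm (H $ n) * s ^ n) - (\<Sum>n. norm (G $ n) * s ^ n))"
  have deriv: "((\<lambda>s. \<Sum>n. norm (P $ n) * s ^ n) has_real_derivative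
      (\<Sum>n. norm (fps_deriv P $ n) * s ^ n)) (at s)"
    if "p holomorphic_on unit_disk" "p has_fps_expansion P" "0 \<le> s" "s < 1" for p s and P :: "complex fps"
  proof -
    \<comment> \<open>Termwise differentiation at \<open>s\<close> needs convergence at a larger point inside the disk.\<close>
    have "summable (\<lambda>n. norm (P $ n) * ((s + 1) / 2) ^ n)"
      by (rule summable_norm_coeffs[OF that(1,2)]) (use that in auto)
    then have "((\<lambda>s. \<Sum>n. norm (P $ n) * s ^ n) has_real_derivative
      (\<Sum>n. diffs (\<lambda>n. norm (P $ n)) n * s ^ n)) (at s)"
      by (rule termdiffs_strong) (use that in auto)
    moreover have "diffs (\<lambda>n. norm (P $ n)) n = norm (fps_deriv P $ n)" for n
      by (simp add: diffs_def norm_mult del: of_nat_Suc)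
    ultimately show ?thesis by simp
  qed
  have "D 0 \<le> D r"
  proof (rule DERIV_nonneg_imp_nondecreasing[OF r(1)])
    fix s assume s: "0 \<le> s" "s \<le> r"
    then have "s < 1" using r by linarith
    then have "(D has_real_derivative
        (\<Sum>n. norm (fps_deriv H $ n) * s ^ n) - (\<Sum>n. norm (fps_deriv G $ n) * s ^ n)) (at s)"
      unfolding D_def by (intro DERIV_diff deriv[OF h H] deriv[OF g G] s)
    moreover have "0 \<le> (\<Sum>n. norm (fps_deriv H $ n) * s ^ n) - (\<Sum>n. norm (fps_deriv G $ n) * s ^ n)"
      using le[of s] s r by simp
    ultimately show "\<exists>y. (D has_real_derivative y) (at s) \<and> 0 \<le> y"
      by blast
  qed
  moreover have "(\<Sum>n. norm (P $ n) * r ^ n) = norm (P $ 0) + (\<Sum>n. norm (P $ Suc n) * r ^ Suc n)"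
    if "p holomorphic_on unit_disk" "p has_fps_expansion P" for p and P :: "complex fps"
    using suminf_split_head[OF summable_norm_coeffs[OF that, of r]] r by simp
  note this[OF h H] this[OF g G]
  moreover have "(\<Sum>n. norm (P $ n) * 0 ^ n) = norm (P $ 0)" for P :: "complex fps"
    using powser_zero[of "\<lambda>n. norm (P $ n)"] by simp
  ultimately show ?thesis by (simp add: D_def)
qed

section \<open>The bound for harmonic mappings and its sharpness\<close>

lemma has_fps_expansion_of_sums:
  fixes a :: "nat \<Rightarrow> complex"
  assumes "\<And>z. z \<in> unit_disk \<Longrightarrow> (\<lambda>n. a n * z ^ n) sums h z"
  shows "h has_fps_expansion Abs_fps a"
  by (rule has_fps_expansionI) (auto simp: eventually_nhds intro!: exI[of _ unit_disk] assms)

text \<open>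
  The positive Jacobian makes the dilatation \<open>w = g' / h'\<close> holomorphic and bounded by 1, so the
  series of \<open>g\<close> is dominated by that of \<open>h\<close> up to radius 1/3, and the latter by a geometric
  series.
\<close>

lemma harmonic_bohr_bound:
  assumes sp: "sense_preserving_harmonic_on f unit_disk" and hs: "harmonic_series f h g a b"
    and le: "\<And>z. z \<in> unit_disk \<Longrightarrow> Re (h z) \<le> 1"
    and r: "0 \<le> r" "r \<le> 1 / 5"
  shows "summable (\<lambda>n. (cmod (a (Suc n)) + cmod (b (Suc n))) * r ^ Suc n) \<and>
         Re (a 0) + (\<Sum>n. (cmod (a (Suc n)) + cmod (b (Suc n))) * r ^ Suc n) \<le> 1"
proof -
  have h: "h holomorphic_on unit_disk" and g: "g holomorphic_on unit_disk"
    and f: "\<And>z. z \<in> unit_disk \<Longrightarrow> f z = h z + cnj (g z)"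
    and ha: "\<And>z. z \<in> unit_disk \<Longrightarrow> (\<lambda>n. a n * z ^ n) sums h z"
    and gb: "\<And>z. z \<in> unit_disk \<Longrightarrow> (\<lambda>n. b (Suc n) * z ^ Suc n) sums g z"
    using hs by (auto simp: harmonic_series_def)
  define H where "H = Abs_fps a"
  \<comment> \<open>The power series of \<open>g\<close> starts at index 1.\<close>
  define G where "G = Abs_fps (b(0 := 0))"
  have H: "h has_fps_expansion H"
    unfolding H_def by (rule has_fps_expansion_of_sums[OF ha])
  have G: "g has_fps_expansion G"
    unfolding G_def
  proof (rule has_fps_expansion_of_sums)
    show "(\<lambda>n. (b(0 := 0)) n * z ^ n) sums g z" if "z \<in> unit_disk" for z
      using gb[OF that] sums_Suc[of "\<lambda>n. (b(0 := 0)) n * z ^ n" "g z"] by simp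
  qed
  have lt: "norm (deriv g z) < norm (deriv h z)" if "z \<in> unit_disk" for z
  proof -
    have "0 < jacobian_det f z"
      using sp that by (auto simp: sense_preserving_harmonic_on_def)
    then have "(norm (deriv g z))\<^sup>2 < (norm (deriv h z))\<^sup>2"
      using jacobian_det_decomp[OF open_ball h g f that] by simp
    then show ?thesis by (rule power_less_imp_less_base) simp
  qed
  have h': "deriv h holomorphic_on unit_disk" and g': "deriv g holomorphic_on unit_disk"
    using h g by (auto intro: holomorphic_deriv)
  define w where "w = (\<lambda>z. deriv g z / deriv h z)"
  have nz: "deriv h z \<noteq> 0" if "z \<in> unit_disk" for z
    using lt[OF that] by auto
  have w: "w holomorphic_on unit_disk"
    unfolding w_def by (intro holomorphic_on_divide g' h' nz)
  define W where "W = fps_expansion w 0"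
  have W: "w has_fps_expansion W"
    unfolding W_def by (rule has_fps_expansion_fps_expansion[OF open_ball _ w]) simp
  have w1: "norm (w z) \<le> 1" if "z \<in> unit_disk" for z
    using lt[OF that] nz[OF that] by (simp add: w_def norm_divide)
  have "deriv g has_fps_expansion W * fps_deriv H"
  proof -
    have "(\<lambda>z. w z * deriv h z) has_fps_expansion W * fps_deriv H"
      by (intro has_fps_expansion_mult W has_fps_expansion_deriv H)
    moreover have "\<forall>\<^sub>F z in nhds 0. w z * deriv h z = deriv g z"
      unfolding eventually_nhds by (intro exI[of _ unit_disk]) (auto simp: w_def nz)
    ultimately show ?thesis
      by (subst has_fps_expansion_cong[OF _ refl, symmetric])
  qed
  then have dG: "fps_deriv G = W * fps_deriv H"
    by (rule fps_expansion_unique_complex[OF has_fps_expansion_deriv[OF G]])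
  have B: "(\<Sum>n. norm (G $ Suc n) * r ^ Suc n) \<le> (\<Sum>n. norm (H $ Suc n) * r ^ Suc n)"
  proof (rule majorant_series_le_of_deriv[OF h H g G, of "1 / 3"])
    show "(\<Sum>n. norm (fps_deriv G $ n) * s ^ n) \<le> (\<Sum>n. norm (fps_deriv H $ n) * s ^ n)"
      if "0 \<le> s" "s \<le> 1 / 3" for s
      unfolding dG
      by (rule majorant_series_le_of_bounded_factor[OF h' has_fps_expansion_deriv[OF H] w W w1 that])
  qed (use r in auto)
  have sH: "summable (\<lambda>n. norm (H $ Suc n) * r ^ Suc n)"
    using summable_norm_coeffs[OF h H, of r] r by (subst summable_Suc_iff) simp
  have sG: "summable (\<lambda>n. norm (G $ Suc n) * r ^ Suc n)"
    using summable_norm_coeffs[OF g G, of r] r by (subst summable_Suc_iff) simp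
  define c where "c = Re (a 0)"
  have "a 0 = h 0"
    using fps_nth_fps_expansion[OF H, of 0] by (simp add: H_def)
  then have c1: "c \<le> 1" using le[of 0] by (simp add: c_def)
  have geo: "(\<lambda>n. 2 * (1 - c) * (r * r ^ n)) sums (2 * (1 - c) * (r * (1 / (1 - r))))"
    by (intro sums_mult geometric_sums) (use r in auto)
  have A: "(\<Sum>n. norm (H $ Suc n) * r ^ Suc n) \<le> 2 * (1 - c) * (r * (1 / (1 - r)))"
    unfolding sums_unique[OF geo]
  proof (rule suminf_le[OF _ sH sums_summable[OF geo]])
    show "norm (H $ Suc n) * r ^ Suc n \<le> 2 * (1 - c) * (r * r ^ n)" for n
      using mult_right_mono[OF coeff_bound_of_Re_le_one[OF h H le, of "Suc n"], of "r ^ Suc n"] r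
      by (simp add: H_def c_def)
  qed
  have split: "(\<lambda>n. (cmod (a (Suc n)) + cmod (b (Suc n))) * r ^ Suc n)
      = (\<lambda>n. norm (H $ Suc n) * r ^ Suc n + norm (G $ Suc n) * r ^ Suc n)"
    by (simp add: H_def G_def distrib_right fun_eq_iff)
  have "(\<Sum>n. norm (H $ Suc n) * r ^ Suc n + norm (G $ Suc n) * r ^ Suc n)
      \<le> 2 * (2 * (1 - c) * (r * (1 / (1 - r))))"
    using suminf_add[OF sH sG] A B by linarith
  also have "\<dots> = (1 - c) * (4 * r / (1 - r))" by simp
  also have "\<dots> \<le> (1 - c) * 1"
    by (rule mult_left_mono) (use r c1 in \<open>auto simp: field_simps\<close>)
  finally show ?thesis
    unfolding split using summable_add[OF sH sG] by (simp add: c_def)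
qed

text \<open>
  With \<open>k(z) = z / (1 - z) = \<Sum>\<^sub>n\<^sub>\<ge>\<^sub>1 z\<^sup>n\<close> take \<open>h = 1/2 - k\<close> and \<open>g = -l k\<close>. Since
  \<open>h = 3/2 - 1 / (1 - z)\<close> and \<open>Re (1 / (1 - z)) > 1/2\<close>, the function \<open>h\<close> maps the disk into
  \<open>{Re < 1}\<close>. The dilatation is the constant \<open>l\<close>, and the left-hand side of the inequality is
  \<open>1/2 + (1 + l) r / (1 - r)\<close>.
\<close>

lemma half_plane_shear_exceeds_one:
  fixes r :: real
  assumes r: "1 / 5 < r" "r < 1"
  shows "\<exists>f h g a b.
     sense_preserving_harmonic_on f unit_disk \<and>
     harmonic_series f h g a b \<and>
     (\<forall>z\<in>unit_disk. Re (h z) \<le> 1) \<and>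
     a 0 \<in> \<real> \<and> 0 < Re (a 0) \<and>
     summable (\<lambda>n. (cmod (a (Suc n)) + cmod (b (Suc n))) * r ^ Suc n) \<and>
     1 < Re (a 0) + (\<Sum>n. (cmod (a (Suc n)) + cmod (b (Suc n))) * r ^ Suc n)"
proof -
  \<comment> \<open>The sum exceeds 1 iff \<open>l > (1 - r) / (2 r) - 1\<close>. The right-hand side is below 1 because
    \<open>r > 1/5\<close>; \<open>l\<close> is the midpoint between it and 1.\<close>
  define l where "l = (1 - r) / (4 * r)"
  have l: "0 < l" "l < 1" using r by (auto simp: l_def field_simps)
  define k where "k = (\<lambda>z::complex. z / (1 - z))"
  define h where "h = (\<lambda>z. 1 / 2 - k z)"
  define g where "g = (\<lambda>z. - of_real l * k z)"
  define f where "f = (\<lambda>z. h z + cnj (g z))"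
  define a where "a = (\<lambda>n::nat. if n = 0 then 1 / 2 else - 1 :: complex)"
  define b where "b = (\<lambda>n::nat. - of_real l :: complex)"
  have ne: "z \<noteq> 1" if "z \<in> unit_disk" for z :: complex
    using that by auto
  have k: "k holomorphic_on unit_disk"
    unfolding k_def by (auto intro!: holomorphic_intros)
  have h: "h holomorphic_on unit_disk" and g: "g holomorphic_on unit_disk"
    unfolding h_def g_def by (intro holomorphic_intros k)+
  have dk: "(k has_field_derivative 1 / (1 - z)\<^sup>2) (at z)" if "z \<in> unit_disk" for z
    unfolding k_def using ne[OF that]
    by (auto intro!: derivative_eq_intros simp: power2_eq_square field_simps)
  have dh: "deriv h z = - 1 / (1 - z)\<^sup>2" and dg: "deriv g z = - of_real l / (1 - z)\<^sup>2"
    if "z \<in> unit_disk" for z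
    unfolding h_def g_def using dk[OF that]
    by (auto intro!: DERIV_imp_deriv derivative_eq_intros)
  have sp: "sense_preserving_harmonic_on f unit_disk"
    unfolding sense_preserving_harmonic_on_def
  proof (intro conjI ballI)
    show "harmonic_on f unit_disk"
      by (rule harmonic_on_decomp[OF open_ball h g]) (simp add: f_def)
    fix z :: complex assume z: "z \<in> unit_disk"
    have "jacobian_det f z = (cmod (deriv h z))\<^sup>2 - (cmod (deriv g z))\<^sup>2"
      by (rule jacobian_det_decomp[OF open_ball h g _ z]) (simp add: f_def)
    also have "\<dots> = (1 - l\<^sup>2) / (cmod (1 - z) ^ 2)\<^sup>2"
      using l by (simp add: dh[OF z] dg[OF z] norm_divide norm_power power_divide diff_divide_distrib)
    also have "\<dots> > 0"
      using l ne[OF z] by (auto intro!: divide_pos_pos simp: power_less_one_iff)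
    finally show "0 < jacobian_det f z" .
  qed
  have ks: "(\<lambda>n. z ^ Suc n) sums k z" if "z \<in> unit_disk" for z
    using sums_mult[OF geometric_sums[of z], of z] that by (simp add: k_def)
  have hs: "harmonic_series f h g a b"
    unfolding harmonic_series_def
  proof (intro conjI ballI h g)
    fix z :: complex assume z: "z \<in> unit_disk"
    show "f z = h z + cnj (g z)" by (simp add: f_def)
    show "(\<lambda>n. a n * z ^ n) sums h z"
      using sums_minus[OF ks[OF z]] sums_Suc[of "\<lambda>n. a n * z ^ n" "- k z"]
      by (simp add: a_def h_def)
    show "(\<lambda>n. b (Suc n) * z ^ Suc n) sums g z"
      using sums_mult[OF ks[OF z], of "- of_real l"] by (simp add: b_def g_def)
  qed
  have Re_h: "Re (h z) \<le> 1" if z: "z \<in> unit_disk" for z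
  proof -
    have n: "(norm z)\<^sup>2 < 1" using z by (simp add: power_less_one_iff)
    have "h z = (3 / 2) - 1 / (1 - z)"
      using ne[OF z] by (simp add: h_def k_def field_simps)
    moreover have "Re (1 / (1 - z)) \<ge> 1 / 2"
    proof -
      have "(1 - Re z)\<^sup>2 + (Im z)\<^sup>2 > 0"
        using ne[OF z] by (auto simp: complex_eq_iff sum_power2_gt_zero_iff)
      with n show ?thesis
        by (simp add: Re_divide cmod_power2 field_simps) (simp add: power2_eq_square algebra_simps)
    qed
    ultimately show ?thesis by simp
  qed
  have "(\<lambda>n. (1 + l) * (r * r ^ n)) sums ((1 + l) * (r * (1 / (1 - r))))"
    by (intro sums_mult geometric_sums) (use r in auto)
  then have S: "(\<lambda>n. (cmod (a (Suc n)) + cmod (b (Suc n))) * r ^ Suc n) sums ((1 + l) * (r * (1 / (1 - r))))"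
    using l by (simp add: a_def b_def)
  have "1 / 2 < (1 + l) * (r * (1 / (1 - r)))"
    using r by (simp add: l_def field_simps)
  moreover have "Re (a 0) = 1 / 2" by (simp add: a_def)
  ultimately have "1 < Re (a 0) + (\<Sum>n. (cmod (a (Suc n)) + cmod (b (Suc n))) * r ^ Suc n)"
    unfolding sums_unique[OF S, symmetric] by linarith
  moreover have "a 0 \<in> \<real>" "0 < Re (a 0)" by (auto simp: a_def)
  ultimately show ?thesis
    using sp hs Re_h sums_summable[OF S] by blast
qed

theorem corollary2:
  shows "(\<forall>f h g a b.
            sense_preserving_harmonic_on f unit_disk \<longrightarrow>
            harmonic_series f h g a b \<longrightarrow>
            (\<forall>z\<in>unit_disk. Re (h z) \<le> 1) \<longrightarrow>
            a 0 \<in> \<real> \<longrightarrow> 0 < Re (a 0) \<longrightarrow>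
            (\<forall>r::real. 0 \<le> r \<longrightarrow> r \<le> 1 / 5 \<longrightarrow>
               summable (\<lambda>n. (cmod (a (Suc n)) + cmod (b (Suc n))) * r ^ Suc n) \<and>
               Re (a 0) + (\<Sum>n. (cmod (a (Suc n)) + cmod (b (Suc n))) * r ^ Suc n) \<le> 1))
       \<and> (\<forall>r::real. 1 / 5 < r \<longrightarrow> r < 1 \<longrightarrow>
            (\<exists>f h g a b.
               sense_preserving_harmonic_on f unit_disk \<and>
               harmonic_series f h g a b \<and>
               (\<forall>z\<in>unit_disk. Re (h z) \<le> 1) \<and>
               a 0 \<in> \<real> \<and> 0 < Re (a 0) \<and>
               summable (\<lambda>n. (cmod (a (Suc n)) + cmod (b (Suc n))) * r ^ Suc n) \<and>
               1 < Re (a 0) + (\<Sum>n. (cmod (a (Suc n)) + cmod (b (Suc n))) * r ^ Suc n)))"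
proof (rule conjI; intro allI impI)
  fix f h g :: "complex \<Rightarrow> complex" and a b :: "nat \<Rightarrow> complex" and r :: real
  assume "sense_preserving_harmonic_on f unit_disk" "harmonic_series f h g a b"
    "\<forall>z\<in>unit_disk. Re (h z) \<le> 1" "0 \<le> r" "r \<le> 1 / 5"
  then show "summable (\<lambda>n. (cmod (a (Suc n)) + cmod (b (Suc n))) * r ^ Suc n) \<and>
      Re (a 0) + (\<Sum>n. (cmod (a (Suc n)) + cmod (b (Suc n))) * r ^ Suc n) \<le> 1"
    by (intro harmonic_bohr_bound[of f h g a b r]) (assumption | erule (1) bspec)+
qed (rule half_plane_shear_exceeds_one)

end
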